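(* Let $1\leq p<\infty$. For any compact metric spaces $X,Y$, $$d_{\mathrm{GH}}(X,Y)=\left(d_{\mathrm{GH}}^{(p)}\left(S_{\frac1p}(X),S_{\frac1p}(Y)\right)\right)^p.$$ Conversely, for any compact $p$-metric spaces $X,Y$, $$d_{\mathrm{GH}}^{(p)}(X,Y)=\left(d_{\mathrm{GH}}(S_p(X),S_p(Y))\right)^{\frac1p}.$$
   Context: All metric spaces are nonempty. For $p\in[1,\infty)$, a $p$-metric space is a metric space satisfying $d(x,x'')^p\le d(x,x')^p+d(x',x'')^p$ for all points. For $q>0$ and a metric space $(X,d_X)$, the snowflake transform is $S_q(X)=(X,(d_X)^q)$. For $p\in[1,\infty)$, $S_{1/p}$ maps compact metric spaces to compact $p$-metric spaces, and $S_p$ maps compact $p$-metric spaces to compact metric spaces. For metric spaces $X,Y$ and $p\in[1,\infty)$, $$d_{\mathrm{GH}}^{(p)}(X,Y)=2^{-\frac1p}\inf_R\ \sup_{(x,y),(x',y')\in R}\left|d_X(x,x')^p-d_Y(y,y')^p\right|^{\frac1p},$$ with $R$ ranging over all correspondences between $X$ and $Y$ (subsets of $X\times Y$ projecting onto both factors). $d_{\mathrm{GH}}=d_{\mathrm{GH}}^{(1)}$ is the usual Gromov-Hausdorff distance. *)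

theory Defs
  imports "HOL-Analysis.Analysis"
begin

definition compact_metric_space :: "'a set \<Rightarrow> ('a \<Rightarrow> 'a \<Rightarrow> real) \<Rightarrow> bool" where
  "compact_metric_space X d \<longleftrightarrow>
     Metric_space X d \<and> X \<noteq> {} \<and> compact_space (Metric_space.mtopology X d)"

definition p_metric_space :: "real \<Rightarrow> 'a set \<Rightarrow> ('a \<Rightarrow> 'a \<Rightarrow> real) \<Rightarrow> bool" where
  "p_metric_space p X d \<longleftrightarrow>
     Metric_space X d \<and> X \<noteq> {} \<and>
     (\<forall>x\<in>X. \<forall>x'\<in>X. \<forall>x''\<in>X. d x x'' powr p \<le> d x x' powr p + d x' x'' powr p)"

(* The snowflake transform keeps the underlying set, so it acts on the distance function only. *)
definition snowflake :: "real \<Rightarrow> ('a \<Rightarrow> 'a \<Rightarrow> real) \<Rightarrow> 'a \<Rightarrow> 'a \<Rightarrow> real" where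
  "snowflake q d = (\<lambda>x x'. d x x' powr q)"

definition correspondences :: "'a set \<Rightarrow> 'b set \<Rightarrow> ('a \<times> 'b) set set" where
  "correspondences X Y = {R. R \<subseteq> X \<times> Y \<and> fst ` R = X \<and> snd ` R = Y}"

(* Inf and Sup are taken in the reals, so the definition is meant for nonempty bounded spaces
   (in particular compact ones and their snowflakes), where the lemmas below show that all
   suprema and the infimum are over nonempty sets bounded on the relevant side. *)
definition pGH_dist ::
  "real \<Rightarrow> 'a set \<Rightarrow> ('a \<Rightarrow> 'a \<Rightarrow> real) \<Rightarrow> 'b set \<Rightarrow> ('b \<Rightarrow> 'b \<Rightarrow> real) \<Rightarrow> real" where
  "pGH_dist p X dX Y dY =
     2 powr (- 1 / p) *
     (INF R \<in> correspondences X Y.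
        SUP ((x, y), (x', y')) \<in> R \<times> R. \<bar>dX x x' powr p - dY y y' powr p\<bar> powr (1 / p))"

abbreviation GH_dist ::
  "'a set \<Rightarrow> ('a \<Rightarrow> 'a \<Rightarrow> real) \<Rightarrow> 'b set \<Rightarrow> ('b \<Rightarrow> 'b \<Rightarrow> real) \<Rightarrow> real" where
  "GH_dist \<equiv> pGH_dist 1"

lemma correspondences_nonempty:
  assumes "X \<noteq> {}" "Y \<noteq> {}"
  shows "X \<times> Y \<in> correspondences X Y"
  using assms by (auto simp: correspondences_def)

lemma correspondence_nonempty:
  assumes "X \<noteq> {}" "R \<in> correspondences X Y"
  shows "R \<noteq> {}"
  using assms by (auto simp: correspondences_def)

lemma bdd_above_pdistortion:
  fixes p A B :: real and dX :: "'a \<Rightarrow> 'a \<Rightarrow> real" and dY :: "'b \<Rightarrow> 'b \<Rightarrow> real"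
  assumes "R \<in> correspondences X Y" "p \<ge> 1"
    and X: "\<And>x x'. x \<in> X \<Longrightarrow> x' \<in> X \<Longrightarrow> 0 \<le> dX x x' \<and> dX x x' \<le> A"
    and Y: "\<And>y y'. y \<in> Y \<Longrightarrow> y' \<in> Y \<Longrightarrow> 0 \<le> dY y y' \<and> dY y y' \<le> B"
  shows "bdd_above ((\<lambda>((x, y), (x', y')). \<bar>dX x x' powr p - dY y y' powr p\<bar> powr (1 / p)) ` (R \<times> R))"
proof (rule bdd_aboveI2)
  fix z assume "z \<in> R \<times> R"
  moreover have "R \<subseteq> X \<times> Y"
    using assms(1) by (simp add: correspondences_def)
  ultimately obtain x y x' y' where z: "z = ((x, y), (x', y'))" "x \<in> X" "x' \<in> X" "y \<in> Y" "y' \<in> Y"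
    by blast
  have "0 \<le> p"
    using \<open>p \<ge> 1\<close> by simp
  then have "dX x x' powr p \<le> A powr p" "dY y y' powr p \<le> B powr p"
    using X[OF z(2,3)] Y[OF z(4,5)] by (auto intro!: powr_mono2)
  moreover have "0 \<le> dX x x' powr p" "0 \<le> dY y y' powr p"
    by simp_all
  ultimately have "\<bar>dX x x' powr p - dY y y' powr p\<bar> \<le> A powr p + B powr p"
    by linarith
  then show "(\<lambda>((x, y), (x', y')). \<bar>dX x x' powr p - dY y y' powr p\<bar> powr (1 / p)) z
      \<le> (A powr p + B powr p) powr (1 / p)"
    using z \<open>p \<ge> 1\<close> by (auto intro!: powr_mono2)
qed

lemma compact_metric_space_bounded:
  assumes "compact_metric_space X d"
  obtains A where "\<And>x x'. x \<in> X \<Longrightarrow> x' \<in> X \<Longrightarrow> 0 \<le> d x x' \<and> d x x' \<le> A"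
proof -
  interpret Metric_space X d
    using assms by (simp add: compact_metric_space_def)
  have "compactin mtopology X"
    using assms by (simp add: compact_metric_space_def compact_space_def)
  then have "mbounded X"
    by (rule compactin_imp_mbounded)
  then obtain A where "\<forall>x\<in>X. \<forall>x'\<in>X. d x x' \<le> A"
    by (auto simp: mbounded_alt)
  then show thesis
    using that[of A] nonneg by blast
qed

lemma snowflake_bounded:
  fixes A q :: real
  assumes "q > 0" "0 \<le> d x x' \<and> d x x' \<le> A"
  shows "0 \<le> snowflake q d x x' \<and> snowflake q d x x' \<le> A powr q"
  using assms by (auto simp: snowflake_def intro!: powr_mono2)

lemma bdd_below_pdistortions:
  fixes p A B :: real and dX :: "'a \<Rightarrow> 'a \<Rightarrow> real" and dY :: "'b \<Rightarrow> 'b \<Rightarrow> real"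
  assumes "X \<noteq> {}" "p \<ge> 1"
    and X: "\<And>x x'. x \<in> X \<Longrightarrow> x' \<in> X \<Longrightarrow> 0 \<le> dX x x' \<and> dX x x' \<le> A"
    and Y: "\<And>y y'. y \<in> Y \<Longrightarrow> y' \<in> Y \<Longrightarrow> 0 \<le> dY y y' \<and> dY y y' \<le> B"
  shows "bdd_below ((\<lambda>R. SUP ((x, y), (x', y')) \<in> R \<times> R.
           \<bar>dX x x' powr p - dY y y' powr p\<bar> powr (1 / p)) ` correspondences X Y)"
proof (rule bdd_belowI2[where m = 0])
  fix R assume R: "R \<in> correspondences X Y"
  then obtain z where z: "z \<in> R"
    using correspondence_nonempty[OF assms(1)] by blast
  have bdd: "bdd_above ((\<lambda>((x, y), (x', y')). \<bar>dX x x' powr p - dY y y' powr p\<bar> powr (1 / p)) ` (R \<times> R))"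
    using R \<open>p \<ge> 1\<close> X Y by (rule bdd_above_pdistortion)
  show "0 \<le> (SUP ((x, y), (x', y')) \<in> R \<times> R.
           \<bar>dX x x' powr p - dY y y' powr p\<bar> powr (1 / p))"
    by (rule cSUP_upper2[OF bdd, of "(z, z)"]) (use z in \<open>auto split: prod.splits\<close>)
qed

end

(* The function t |-> t^(1/p) is continuous and increasing on the nonnegative reals, so it commutes
   with the supremum over a correspondence and the infimum over all correspondences. Hence the
   p-distance of two spaces is the 1/p-th power of the ordinary distance of their p-snowflakes; the
   other identity follows since the p-snowflake undoes the 1/p-snowflake. *)
theory Submission
  imports Defs
begin

(* Library facts on monotone continuous functions need monotonicity on all of the reals, but powr
   at a negative base is not monotone; hence the truncation max 0. *)
lemma mono_max_powr:
  fixes r :: real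
  assumes "0 \<le> r"
  shows "mono (\<lambda>t::real. max 0 t powr r)"
  using assms by (intro monoI powr_mono2) auto

lemma isCont_max_powr:
  fixes r x :: real
  assumes "0 < r"
  shows "isCont (\<lambda>t::real. max 0 t powr r) x"
  unfolding isCont_def
  \<comment> \<open>Where the base tends to 0, continuity rests on \<open>0 < r\<close> and on the
    base being nonnegative throughout.\<close>
  by (rule tendsto_powr') (use assms in \<open>auto intro!: tendsto_intros\<close>)

text \<open>The truncated power is monotone and continuous, so it passes through \<open>Sup\<close>.
  The truncation disappears because all values, and hence their supremum, are nonnegative.\<close>

lemma cSUP_powr:
  fixes f :: "'c \<Rightarrow> real"
  assumes "0 < r" "A \<noteq> {}" "bdd_above (f ` A)" and nonneg: "\<And>a. a \<in> A \<Longrightarrow> 0 \<le> f a"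
  shows "(SUP a\<in>A. f a powr r) = (SUP a\<in>A. f a) powr r"
proof -
  obtain a where "a \<in> A"
    using assms(2) by blast
  then have "0 \<le> (SUP a\<in>A. f a)"
    using assms(3) nonneg by (intro cSUP_upper2[of f A a]) auto
  then have "(SUP a\<in>A. f a) powr r = max 0 (SUP a\<in>A. f a) powr r"
    by simp
  also have "\<dots> = (SUP t\<in>f ` A. max 0 t powr r)"
    using assms
    by (intro continuous_at_Sup_mono mono_max_powr
        continuous_at_imp_continuous_at_within[OF isCont_max_powr]) auto
  also have "\<dots> = (SUP a\<in>A. f a powr r)"
    unfolding image_image using nonneg by (intro SUP_cong) auto
  finally show ?thesis ..
qed

text \<open>Dual to \<open>cSUP_powr\<close>; here 0 serves as the lower bound of the
  values.\<close>

lemma cINF_powr: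
  fixes f :: "'c \<Rightarrow> real"
  assumes "0 < r" "A \<noteq> {}" and nonneg: "\<And>a. a \<in> A \<Longrightarrow> 0 \<le> f a"
  shows "(INF a\<in>A. f a powr r) = (INF a\<in>A. f a) powr r"
proof -
  have "0 \<le> (INF a\<in>A. f a)"
    using assms by (intro cINF_greatest)
  then have "(INF a\<in>A. f a) powr r = max 0 (INF a\<in>A. f a) powr r"
    by simp
  also have "\<dots> = (INF t\<in>f ` A. max 0 t powr r)"
    using assms
    by (intro continuous_at_Inf_mono mono_max_powr bdd_belowI2[where m = 0]
        continuous_at_imp_continuous_at_within[OF isCont_max_powr]) auto
  also have "\<dots> = (INF a\<in>A. f a powr r)"
    unfolding image_image using nonneg by (intro INF_cong) auto
  finally show ?thesis ..
qed

text \<open>Only nonnegativity and boundedness are assumed, so that the result applies to metrics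
  and to their snowflakes alike. The second claim later allows the power \<open>1 / p\<close> to be
  inverted.\<close>

lemma
  fixes p A B :: real and dX :: "'a \<Rightarrow> 'a \<Rightarrow> real" and dY :: "'b \<Rightarrow> 'b \<Rightarrow> real"
  assumes p: "1 \<le> p" and ne: "X \<noteq> {}" "Y \<noteq> {}"
    and X: "\<And>x x'. x \<in> X \<Longrightarrow> x' \<in> X \<Longrightarrow> 0 \<le> dX x x' \<and> dX x x' \<le> A"
    and Y: "\<And>y y'. y \<in> Y \<Longrightarrow> y' \<in> Y \<Longrightarrow> 0 \<le> dY y y' \<and> dY y y' \<le> B"
  shows pGH_dist_eq_GH_dist_snowflake_powr:
      "pGH_dist p X dX Y dY = GH_dist X (snowflake p dX) Y (snowflake p dY) powr (1 / p)"
    and GH_dist_snowflake_nonneg: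
      "0 \<le> GH_dist X (snowflake p dX) Y (snowflake p dY)"
proof -
  \<comment> \<open>The common core of both distances: \<open>S R\<close> is the distortion of
    \<open>R\<close> for the p-snowflakes, while the p-distance takes the root of \<open>f\<close>
    inside the supremum.\<close>
  define f where "f = (\<lambda>((x, y), (x', y')). \<bar>dX x x' powr p - dY y y' powr p\<bar>)"
  define S where "S R = (SUP z\<in>R \<times> R. f z)" for R
  have C: "correspondences X Y \<noteq> {}"
    using correspondences_nonempty[OF ne] by blast
  have f_nonneg: "0 \<le> f z" for z
    by (auto simp: f_def split: prod.splits)
  have R_ne: "R \<times> R \<noteq> {}" if "R \<in> correspondences X Y" for R
    using correspondence_nonempty[OF ne(1) that] by blast
  have bdd: "bdd_above (f ` (R \<times> R))" if "R \<in> correspondences X Y" for R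
  proof -
    \<comment> \<open>Boundedness of \<open>f\<close> is the case of exponent 1 for the snowflakes,
      since the outer powers collapse.\<close>
    have "bdd_above ((\<lambda>((x, y), (x', y')).
        \<bar>snowflake p dX x x' powr 1 - snowflake p dY y y' powr 1\<bar> powr (1 / 1)) ` (R \<times> R))"
      by (rule bdd_above_pdistortion[OF that, where A = "A powr p" and B = "B powr p"])
         (use p X Y in \<open>auto intro!: snowflake_bounded\<close>)
    then show ?thesis
      by (simp add: f_def snowflake_def case_prod_unfold)
  qed
  have S_nonneg: "0 \<le> S R" if R: "R \<in> correspondences X Y" for R
  proof -
    obtain z where "z \<in> R \<times> R"
      using R_ne[OF R] by blast
    then show ?thesis
      unfolding S_def using bdd[OF R] f_nonneg by (intro cSUP_upper2[of f "R \<times> R" z])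
  qed
  have GH: "GH_dist X (snowflake p dX) Y (snowflake p dY)
      = 2 powr (- 1) * (INF R\<in>correspondences X Y. S R)"
    by (simp add: pGH_dist_def S_def f_def snowflake_def case_prod_unfold)
  have INF_nonneg: "0 \<le> (INF R\<in>correspondences X Y. S R)"
    using C S_nonneg by (intro cINF_greatest)
  then show "0 \<le> GH_dist X (snowflake p dX) Y (snowflake p dY)"
    unfolding GH by simp
  have "pGH_dist p X dX Y dY = 2 powr (- 1 / p) *
      (INF R\<in>correspondences X Y. SUP z\<in>R \<times> R. f z powr (1 / p))"
    by (simp add: pGH_dist_def f_def case_prod_unfold)
  also have "(INF R\<in>correspondences X Y. SUP z\<in>R \<times> R. f z powr (1 / p))
      = (INF R\<in>correspondences X Y. S R powr (1 / p))"
    unfolding S_def using p R_ne bdd f_nonneg by (intro INF_cong cSUP_powr) auto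
  also have "\<dots> = (INF R\<in>correspondences X Y. S R) powr (1 / p)"
    using p C S_nonneg by (intro cINF_powr) auto
  \<comment> \<open>The normalizing constant fits: \<open>2 powr (- 1 / p)\<close> is the power
    \<open>1 / p\<close> of \<open>2 powr (- 1)\<close>.\<close>
  also have "2 powr (- 1 / p) * \<dots>
      = GH_dist X (snowflake p dX) Y (snowflake p dY) powr (1 / p)"
    unfolding GH powr_mult powr_powr by simp
  finally show "pGH_dist p X dX Y dY
      = GH_dist X (snowflake p dX) Y (snowflake p dY) powr (1 / p)" .
qed

text \<open>The exponents multiply to 1, and \<open>powr 1\<close> fixes nonnegative reals.
  Nonnegativity is asked on the whole type because the equation is between functions.\<close>

lemma snowflake_snowflake_inverse:
  assumes "p \<noteq> 0" "\<And>x x'. 0 \<le> d x x'"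
  shows "snowflake p (snowflake (1 / p) d) = d"
  using assms by (simp add: snowflake_def powr_powr)

theorem proposition4p10:
  fixes p :: real
  assumes "1 \<le> p"
  shows "(\<forall>(X :: 'a set) dX (Y :: 'b set) dY.
            compact_metric_space X dX \<longrightarrow> compact_metric_space Y dY \<longrightarrow>
            GH_dist X dX Y dY
              = (pGH_dist p X (snowflake (1 / p) dX) Y (snowflake (1 / p) dY)) powr p)
       \<and> (\<forall>(X :: 'a set) dX (Y :: 'b set) dY.
            compact_metric_space X dX \<longrightarrow> p_metric_space p X dX \<longrightarrow>
            compact_metric_space Y dY \<longrightarrow> p_metric_space p Y dY \<longrightarrow>
            pGH_dist p X dX Y dY
              = (GH_dist X (snowflake p dX) Y (snowflake p dY)) powr (1 / p))"
proof (intro conjI allI impI)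
  fix X :: "'a set" and dX and Y :: "'b set" and dY
  assume X: "compact_metric_space X dX" and Y: "compact_metric_space Y dY"
  have ne: "X \<noteq> {}" "Y \<noteq> {}"
    using X Y by (auto simp: compact_metric_space_def)
  obtain A where A: "\<And>x x'. x \<in> X \<Longrightarrow> x' \<in> X \<Longrightarrow> 0 \<le> dX x x' \<and> dX x x' \<le> A"
    using compact_metric_space_bounded[OF X] by blast
  obtain B where B: "\<And>y y'. y \<in> Y \<Longrightarrow> y' \<in> Y \<Longrightarrow> 0 \<le> dY y y' \<and> dY y y' \<le> B"
    using compact_metric_space_bounded[OF Y] by blast
  show "pGH_dist p X dX Y dY = GH_dist X (snowflake p dX) Y (snowflake p dY) powr (1 / p)"
    using assms ne A B by (rule pGH_dist_eq_GH_dist_snowflake_powr)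
  have r: "0 < 1 / p"
    using assms by simp
  have bounds: "\<And>x x'. x \<in> X \<Longrightarrow> x' \<in> X \<Longrightarrow>
        0 \<le> snowflake (1 / p) dX x x' \<and> snowflake (1 / p) dX x x' \<le> A powr (1 / p)"
      "\<And>y y'. y \<in> Y \<Longrightarrow> y' \<in> Y \<Longrightarrow>
        0 \<le> snowflake (1 / p) dY y y' \<and> snowflake (1 / p) dY y y' \<le> B powr (1 / p)"
    by (rule snowflake_bounded[OF r], rule A B; assumption)+
  have inverse: "snowflake p (snowflake (1 / p) dX) = dX"
      "snowflake p (snowflake (1 / p) dY) = dY"
    using X Y assms
    by (auto intro!: snowflake_snowflake_inverse simp: compact_metric_space_def Metric_space.nonneg)
  \<comment> \<open>The same lemma, now for the 1/p-snowflakes, whose p-snowflakes are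
    \<open>dX\<close> and \<open>dY\<close> again.\<close>
  have "pGH_dist p X (snowflake (1 / p) dX) Y (snowflake (1 / p) dY)
      = GH_dist X dX Y dY powr (1 / p)"
    using pGH_dist_eq_GH_dist_snowflake_powr[where dX = "snowflake (1 / p) dX" and dY = "snowflake (1 / p) dY",
        OF assms ne bounds]
    by (simp add: inverse)
  \<comment> \<open>Needed for the power \<open>p\<close> to cancel the power
    \<open>1 / p\<close>.\<close>
  moreover have "0 \<le> GH_dist X dX Y dY"
    using GH_dist_snowflake_nonneg[where dX = "snowflake (1 / p) dX" and dY = "snowflake (1 / p) dY",
        OF assms ne bounds]
    by (simp add: inverse)
  ultimately show "GH_dist X dX Y dY
      = pGH_dist p X (snowflake (1 / p) dX) Y (snowflake (1 / p) dY) powr p"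
    using assms by (simp add: powr_powr)
qed

end
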